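(* Let $n,d\geq 1$, let $P(\lambda)=A_0+A_1\lambda+\dots+A_d\lambda^d$ be a matrix polynomial of degree $d$ with $A_j\in\mathbb{C}^{n\times n}$, and let $\zeta_1,\dots,\zeta_{nd}$ be its eigenvalues, arranged by non-decreasing modulus. Let $\|\cdot\|$ be any norm on $\mathbb{C}^{n\times n}$ satisfying (A1), assume $\det A_0\neq 0$, and let $c=\frac{|\det A_0|}{\|A_0\|^n}$. Let $\alpha_1\leq\dots\leq\alpha_d$ be the tropical roots of $\mathsf{t}p(x)=\max_{0\leq j\leq d}\|A_j\|x^j$, and let $\alpha_0=0$, $\alpha_{d+1}=+\infty$. Let $k\in\{1,\dots,d\}$ and put $\delta_-:=\alpha_{k-1}/\alpha_k$ and $\delta_+:=\alpha_k/\alpha_{k+1}$. Then $$\frac{|\zeta_1\cdots\zeta_{nk}|}{(\alpha_1\cdots\alpha_k)^n}\geq c\,(L_k^\sharp)^n,\qquad L_k^\sharp:=\frac{1-\delta_-\delta_+}{(1+\sqrt{\delta_+})^2}.$$ Moreover, when $\|\cdot\|$ satisfies (A2), the constant $L_k^\sharp$ in this inequality can be replaced by $$L_k^{*\sharp}:=\frac{\sqrt{1-\delta_-^2\delta_+^2}}{1+\delta_+}.$$ These constants satisfy $L_k^\sharp\geq L_k$ and $L_k^{*\sharp}\geq L_k^*$, where $$L_k:=\max\left(\frac{1-\sqrt{\delta_+}}{1+\sqrt{\delta_+}},\ \frac{1-\delta_-}{4(1+\delta_-)}\right),\qquad L_k^*:=\max\left(\sqrt{\frac{1-\delta_+}{1+\delta_+}},\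 \frac12\sqrt{\frac{1-\delta_-^2}{1+\delta_-^2}}\right).$$
   Context: (A1): $|\det A|\leq\|A\|^n$ for all $A\in\mathbb{C}^{n\times n}$. (A2): there exist $Q,Q'\in\mathbb{C}^{n\times n}$ with $\det Q=\det Q'=1$ and $\|QAQ'\|_{\mathrm{nF}}\leq\|A\|$ for all $A\in\mathbb{C}^{n\times n}$, where $\|A\|_{\mathrm{nF}}=\big(\frac1n\sum_{i,j=1}^n|A_{ij}|^2\big)^{1/2}$ is the normalized Frobenius norm. Degree $d$ means $A_d\neq0$. The eigenvalues of $P$ are the roots of the polynomial $\det P(\lambda)$ counted with multiplicities; if $\det P$ has degree less than $nd$, the list is completed to $nd$ entries by infinite eigenvalues, whose modulus is $+\infty$. The tropical roots of $\mathsf{t}p$ are the unique numbers $0\leq\alpha_1\leq\dots\leq\alpha_d$ such that $\mathsf{t}p(x)=\|A_d\|\prod_{j=1}^d\max(x,\alpha_j)$ for all $x\geq0$. They are all positive when $A_0\neq0$. Ratios with denominator $\alpha_{d+1}=+\infty$ are $0$. *)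

theory Defs
  imports "HOL-Analysis.Analysis" "HOL-Computational_Algebra.Polynomial"
begin

text \<open>
  A matrix polynomial with coefficients in the complex $n \times n$ matrices is given by its
  coefficient sequence \<open>A\<close>, of which only \<open>A 0, \<dots>, A d\<close> are used; \<open>n\<close> is \<open>CARD('n)\<close>.
\<close>

definition is_matrix_space_norm :: "(complex^'n^'n \<Rightarrow> real) \<Rightarrow> bool" where
  "is_matrix_space_norm N \<longleftrightarrow>
     (\<forall>X. 0 \<le> N X) \<and>
     (\<forall>X. N X = 0 \<longleftrightarrow> X = 0) \<and>
     (\<forall>(c::complex) X. N (\<chi> i j. c * X $ i $ j) = cmod c * N X) \<and>
     (\<forall>X Y. N (X + Y) \<le> N X + N Y)"

definition cond_A1 :: "(complex^'n^'n \<Rightarrow> real) \<Rightarrow> bool" where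
  "cond_A1 N \<longleftrightarrow> (\<forall>X. cmod (det X) \<le> N X ^ CARD('n))"

definition norm_nF :: "complex^'n^'n \<Rightarrow> real" where
  "norm_nF X = sqrt (1 / real CARD('n) * (\<Sum>i\<in>UNIV. \<Sum>j\<in>UNIV. (cmod (X $ i $ j))\<^sup>2))"

definition cond_A2 :: "(complex^'n^'n \<Rightarrow> real) \<Rightarrow> bool" where
  "cond_A2 N \<longleftrightarrow>
     (\<exists>Q Q'. det Q = 1 \<and> det Q' = 1 \<and> (\<forall>X. norm_nF (Q ** X ** Q') \<le> N X))"

definition matpoly :: "(nat \<Rightarrow> complex^'n^'n) \<Rightarrow> nat \<Rightarrow> complex poly^'n^'n" where
  "matpoly A d = (\<chi> i j. \<Sum>l\<le>d. monom (A l $ i $ j) l)"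

text \<open>
  Eigenvalues live in \<open>complex option\<close>, where \<open>None\<close> stands for the infinite eigenvalue.
  The multiset below is meaningful only if the determinant is not the zero polynomial.
\<close>

definition eigenvalues :: "(nat \<Rightarrow> complex^'n^'n) \<Rightarrow> nat \<Rightarrow> complex option multiset" where
  "eigenvalues A d =
     image_mset Some (proots (det (matpoly A d))) +
     replicate_mset (CARD('n) * d - degree (det (matpoly A d))) None"

definition modulus :: "complex option \<Rightarrow> ereal" where
  "modulus z = (case z of None \<Rightarrow> \<infinity> | Some w \<Rightarrow> ereal (cmod w))"

definition eigenvalues_by_modulus ::
    "(nat \<Rightarrow> complex^'n^'n) \<Rightarrow> nat \<Rightarrow> (nat \<Rightarrow> complex option) \<Rightarrow> bool" where
  "eigenvalues_by_modulus A d \<zeta> \<longleftrightarrow>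
     image_mset \<zeta> (mset_set {1..CARD('n) * d}) = eigenvalues A d \<and>
     mono_on {1..CARD('n) * d} (\<lambda>j. modulus (\<zeta> j))"

definition trop_poly ::
    "(complex^'n^'n \<Rightarrow> real) \<Rightarrow> (nat \<Rightarrow> complex^'n^'n) \<Rightarrow> nat \<Rightarrow> real \<Rightarrow> real" where
  "trop_poly N A d x = Max ((\<lambda>j. N (A j) * x ^ j) ` {0..d})"

definition tropical_roots ::
    "(complex^'n^'n \<Rightarrow> real) \<Rightarrow> (nat \<Rightarrow> complex^'n^'n) \<Rightarrow> nat \<Rightarrow> (nat \<Rightarrow> real) \<Rightarrow> bool" where
  "tropical_roots N A d \<alpha> \<longleftrightarrow>
     (\<forall>j\<in>{1..d}. 0 \<le> \<alpha> j) \<and> mono_on {1..d} \<alpha> \<and>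
     (\<forall>x\<ge>0. trop_poly N A d x = N (A d) * (\<Prod>j=1..d. max x (\<alpha> j)))"

text \<open>In the following constants the arguments are \<open>\<delta>\<^sub>-\<close> and \<open>\<delta>\<^sub>+\<close>, in this order.\<close>

definition L_sharp :: "real \<Rightarrow> real \<Rightarrow> real" where
  "L_sharp \<delta>m \<delta>p = (1 - \<delta>m * \<delta>p) / (1 + sqrt \<delta>p)\<^sup>2"

definition L_star_sharp :: "real \<Rightarrow> real \<Rightarrow> real" where
  "L_star_sharp \<delta>m \<delta>p = sqrt (1 - \<delta>m\<^sup>2 * \<delta>p\<^sup>2) / (1 + \<delta>p)"

definition L_max :: "real \<Rightarrow> real \<Rightarrow> real" where
  "L_max \<delta>m \<delta>p =
     max ((1 - sqrt \<delta>p) / (1 + sqrt \<delta>p)) ((1 - \<delta>m) / (4 * (1 + \<delta>m)))"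

definition L_star_max :: "real \<Rightarrow> real \<Rightarrow> real" where
  "L_star_max \<delta>m \<delta>p =
     max (sqrt ((1 - \<delta>p) / (1 + \<delta>p))) (1 / 2 * sqrt ((1 - \<delta>m\<^sup>2) / (1 + \<delta>m\<^sup>2)))"

end

theory Submission
  imports Defs "HOL-Computational_Algebra.Fundamental_Theorem_Algebra"
begin

text \<open>
  Write \<open>p(z) = det P(z)\<close>, so that \<open>p(0) = det A\<^sub>0 \<noteq> 0\<close>, and put \<open>m = n k\<close>. Jensen's formula
  bounds the product of any \<open>m\<close> roots of \<open>p\<close> from below, for every radius \<open>r > 0\<close>:
  \<open>\<bar>p(0)\<bar> r^m / \<bar>\<zeta>\<^sub>1 \<dots> \<zeta>\<^sub>m\<bar>\<close> is at most the geometric mean of \<open>\<bar>p\<bar>\<close> on the circle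
  \<open>\<bar>z\<bar> = r\<close>. It remains to bound that mean by the norms of the coefficients. By (A1) and the
  triangle inequality it is at most \<open>(\<Sum>\<^sub>j \<parallel>A\<^sub>j\<parallel> r^j)^n\<close>. Under (A2) one gains: Hadamard's
  inequality and the inequality of the means give
  \<open>\<bar>det X\<bar> \<le> \<parallel>X\<parallel>\<^sub>n\<^sub>F^n\<close>, a second use of the inequality of the means, now on the circle, replaces
  the geometric mean by the quadratic one, and Parseval's identity evaluates the latter; the
  result is \<open>(\<Sum>\<^sub>j \<parallel>A\<^sub>j\<parallel>\<^sup>2 r^(2j))^(n/2)\<close>.

  The tropical roots enter through \<open>\<parallel>A\<^sub>j\<parallel> \<le> \<parallel>A\<^sub>0\<parallel> / (\<alpha>\<^sub>1 \<dots> \<alpha>\<^sub>j)\<close>. At \<open>r = \<alpha>\<^sub>k t\<close> the terms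
  of the majorant decay geometrically above \<open>j = k\<close>, with ratio at most \<open>\<delta>\<^sub>+ t < 1\<close>, and below
  \<open>j = k - 1\<close>, with ratio at most \<open>\<delta>\<^sub>-/t < 1\<close>, while the term of index \<open>k - 1\<close> is \<open>1/t\<close> times that of
  index \<open>k\<close>. Hence the sum is at most \<open>\<parallel>A\<^sub>0\<parallel> r^k / (\<alpha>\<^sub>1 \<dots> \<alpha>\<^sub>k)\<close> times
  \<open>1/(1 - \<delta>\<^sub>+ t) + 1/(t - \<delta>\<^sub>-)\<close>, and the infimum of the last factor over \<open>\<delta>\<^sub>- < t < 1/\<delta>\<^sub>+\<close> is exactly
  \<open>1/L\<close> for the constant \<open>L\<close> of the theorem, which vanishes when this interval is empty. Under (A2) the
  same estimate is applied to the squares \<open>\<alpha>\<^sub>j\<^sup>2\<close> and \<open>\<parallel>A\<^sub>j\<parallel>\<^sup>2\<close>, which is why the starred constant is the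
  square root of the unstarred one at the squared ratios.

  Circles are discretized throughout: means over the \<open>N\<close>-th roots of unity replace integrals.
  Parseval's identity then is the orthogonality of characters, and Jensen's
  formula (\<open>discrete_jensen\<close>) comes from the factorization of \<open>x^N - 1\<close> as \<open>N \<rightarrow> \<infinity>\<close>. The other
  main lemmas are \<open>prod_det_le_A1\<close>, \<open>prod_det_le_A2\<close>, \<open>sum_at_tropical_root\<close> and
  \<open>L_sharp_le_if_bounds\<close>.
\<close>

section \<open>Means over roots of unity\<close>

text \<open>
  The inequality of the arithmetic and geometric means. After scaling the mean to \<open>1\<close>, it is the
  product of the inequalities \<open>x \<le> exp (x - 1)\<close>.
\<close>

lemma prod_le_mean_power:
  fixes x :: "'a \<Rightarrow> real"
  assumes "finite S" "S \<noteq> {}" "\<And>i. i \<in> S \<Longrightarrow> 0 \<le> x i"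
  shows "(\<Prod>i\<in>S. x i) \<le> (sum x S / card S) ^ card S"
proof -
  define \<mu> where "\<mu> = sum x S / card S"
  have c: "real (card S) > 0" using assms by (simp add: card_gt_0_iff)
  have s0: "0 \<le> sum x S" using assms by (intro sum_nonneg) auto
  show ?thesis
  proof (cases "sum x S = 0")
    case True
    then have "x i = 0" if "i \<in> S" for i
      using that assms sum_nonneg_eq_0_iff[of S x] by auto
    moreover obtain i where "i \<in> S" using assms by auto
    ultimately have "(\<Prod>i\<in>S. x i) = 0" using assms by (intro prod_zero) auto
    then show ?thesis using s0 c by simp
  next
    case False
    then have mu: "\<mu> > 0" using s0 c by (simp add: \<mu>_def)
    have "(\<Prod>i\<in>S. x i / \<mu>) \<le> (\<Prod>i\<in>S. exp (x i / \<mu> - 1))"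
    proof (intro prod_mono conjI)
      fix i assume "i \<in> S"
      then show "0 \<le> x i / \<mu>" using assms mu by simp
      show "x i / \<mu> \<le> exp (x i / \<mu> - 1)" using exp_ge_add_one_self[of "x i / \<mu> - 1"] by simp
    qed
    also have "\<dots> = exp (\<Sum>i\<in>S. x i / \<mu> - 1)" using assms by (simp add: exp_sum)
    also have "(\<Sum>i\<in>S. x i / \<mu> - 1) = 0"
      using mu c False by (simp add: sum_subtractf flip: sum_divide_distrib) (simp add: \<mu>_def)
    finally have "(\<Prod>i\<in>S. x i) / \<mu> ^ card S \<le> 1" by (simp add: prod_dividef)
    then show ?thesis using mu by (simp add: \<mu>_def[symmetric])
  qed
qed

text \<open>
  The factorization of \<open>x^n - 1\<close>: the polynomial is monic and square-free, hence the product of the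
  linear factors of its distinct roots.
\<close>

lemma prod_minus_roots_of_unity:
  fixes x :: complex
  assumes "n > 0"
  shows "(\<Prod>w | w ^ n = 1. x - w) = x ^ n - 1"
proof -
  define p :: "complex poly" where "p = monom 1 n - 1"
  have ev: "poly p z = z ^ n - 1" for z by (simp add: p_def poly_monom)
  have d: "pderiv p = monom (of_nat n) (n - 1)"
    by (simp add: p_def pderiv_diff pderiv_monom)
  have deg: "degree p = n" "lead_coeff p = 1"
  proof -
    have "degree (1 :: complex poly) < degree (monom 1 n :: complex poly)"
      using assms by (simp add: degree_monom_eq)
    then have *: "degree p = degree (monom 1 n :: complex poly)"
      unfolding p_def diff_conv_add_uminus by (intro degree_add_eq_left) simp
    then show "degree p = n" by (simp add: degree_monom_eq)
    then show "lead_coeff p = 1" using assms by (simp add: p_def)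
  qed
  have "rsquarefree p"
    unfolding rsquarefree_roots ev d using assms by (auto simp: poly_monom zero_power)
  from complex_poly_decompose_rsquarefree[OF this]
  have "poly (\<Prod>z | z ^ n = 1. [:- z, 1:]) x = poly p x" unfolding deg(2) by (simp add: ev)
  then show ?thesis by (simp add: poly_prod ev)
qed

lemma norm_root_of_unity:
  fixes w :: complex
  assumes "n > 0" "w ^ n = 1"
  shows "cmod w = 1"
  using assms by (metis norm_power norm_one power_eq_1_iff norm_ge_zero not_gr_zero zero_less_iff_neq_zero)

text \<open>
  Multiplication by a root of unity \<open>\<omega>\<close> permutes the summation range and multiplies the sum by
  \<open>\<omega>^l\<close> times the conjugate of \<open>\<omega>^m\<close>. So the sum vanishes once some \<open>\<omega>\<close> has \<open>\<omega>^l \<noteq> \<omega>^m\<close>, and one exists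
  because otherwise all \<open>n\<close> roots would satisfy \<open>w^\<bar>l - m\<bar> = 1\<close> with \<open>\<bar>l - m\<bar> < n\<close>.
\<close>

lemma roots_of_unity_orthogonal:
  assumes "l < n" "m < n" "l \<noteq> m"
  shows "(\<Sum>w | w ^ n = (1::complex). w ^ l * cnj (w ^ m)) = 0"
proof -
  define U where "U = {w. w ^ n = (1::complex)}"
  have n: "n > 0" using assms by simp
  have ex: "\<exists>\<omega>\<in>U. \<omega> ^ l \<noteq> \<omega> ^ m" if "l < m" "m < n" for l m
  proof (rule ccontr)
    assume no: "\<not> (\<exists>\<omega>\<in>U. \<omega> ^ l \<noteq> \<omega> ^ m)"
    have "U \<subseteq> {w. w ^ (m - l) = 1}"
    proof
      fix w assume w: "w \<in> U"
      then have "w \<noteq> 0" using n by (auto simp: U_def power_0_left)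
      moreover have "w ^ l * w ^ (m - l) = w ^ l"
        using that w no by (metis power_add le_add_diff_inverse less_imp_le)
      ultimately show "w \<in> {w. w ^ (m - l) = 1}" by simp
    qed
    then have "card U \<le> card {w :: complex. w ^ (m - l) = 1}"
      using that by (intro card_mono finite_nth_roots) auto
    then have "n \<le> m - l" using that n by (simp add: U_def card_roots_unity_eq)
    then show False using that by simp
  qed
  obtain \<omega> where w: "\<omega> \<in> U" "\<omega> ^ l \<noteq> \<omega> ^ m"
    using assms ex[of l m] ex[of m l] by (metis nat_neq_iff)
  have 1: "\<omega> ^ m * cnj (\<omega> ^ m) = 1"
    using w norm_root_of_unity[OF n, of \<omega>]
    by (metis (mono_tags) U_def complex_norm_square mem_Collect_eq norm_power of_real_1 power_one)
  have w0: "\<omega> \<noteq> 0" using w n by (auto simp: U_def power_0_left)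
  define S where "S = (\<Sum>w\<in>U. w ^ l * cnj (w ^ m))"
  have "bij_betw ((*) \<omega>) U U"
  proof (rule bij_betwI[where g = "\<lambda>z. z / \<omega>"])
  qed (use w w0 in \<open>auto simp: U_def power_mult_distrib power_divide\<close>)
  then have "S = (\<Sum>w\<in>U. (\<omega> * w) ^ l * cnj ((\<omega> * w) ^ m))"
    unfolding S_def by (rule sum.reindex_bij_betw[symmetric])
  also have "\<dots> = \<omega> ^ l * cnj (\<omega> ^ m) * S"
    by (simp add: S_def sum_distrib_left power_mult_distrib mult_ac)
  finally have "S = 0 \<or> \<omega> ^ l * cnj (\<omega> ^ m) = 1" by auto
  moreover have "\<omega> ^ l * cnj (\<omega> ^ m) \<noteq> 1"
    using 1 w(2) by (metis mult_cancel_right mult_zero_right zero_neq_one)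
  ultimately show ?thesis unfolding S_def U_def by blast
qed

text \<open>
  Discrete Parseval identity: as \<open>d < n\<close>, distinct exponents stay distinct modulo \<open>n\<close>, so the cross
  terms vanish exactly.
\<close>

lemma parseval_roots_of_unity:
  fixes b :: "nat \<Rightarrow> complex"
  assumes "d < n"
  shows "(\<Sum>w | w ^ n = 1. (cmod (\<Sum>l\<le>d. b l * w ^ l))\<^sup>2) = n * (\<Sum>l\<le>d. (cmod (b l))\<^sup>2)"
proof -
  define U where "U = {w. w ^ n = (1::complex)}"
  have n: "n > 0" using assms by simp
  have o: "(\<Sum>w\<in>U. w ^ l * cnj (w ^ m)) = (if l = m then of_nat n else 0)" if "l \<le> d" "m \<le> d" for l m
  proof (cases "l = m")
    case True
    have "(\<Sum>w\<in>U. w ^ l * cnj (w ^ l)) = (\<Sum>w\<in>U. 1)"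
    proof (rule sum.cong[OF refl])
      fix w assume "w \<in> U"
      then have "cmod w = 1" using norm_root_of_unity[OF n] by (auto simp: U_def)
      then show "w ^ l * cnj (w ^ l) = 1"
        by (metis complex_norm_square norm_power power_one of_real_1)
    qed
    then show ?thesis using True n by (simp add: U_def card_roots_unity_eq)
  next
    case False
    then show ?thesis using roots_of_unity_orthogonal[of l n m] that assms by (simp add: U_def)
  qed
  have "complex_of_real (\<Sum>w\<in>U. (cmod (\<Sum>l\<le>d. b l * w ^ l))\<^sup>2)
      = (\<Sum>w\<in>U. \<Sum>l\<le>d. \<Sum>m\<le>d. b l * cnj (b m) * (w ^ l * cnj (w ^ m)))"
    unfolding of_real_sum complex_norm_square
    by (simp add: sum_product cnj_sum mult_ac)
  also have "\<dots> = (\<Sum>l\<le>d. \<Sum>w\<in>U. \<Sum>m\<le>d. b l * cnj (b m) * (w ^ l * cnj (w ^ m)))"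
    by (rule sum.swap)
  also have "\<dots> = (\<Sum>l\<le>d. \<Sum>m\<le>d. \<Sum>w\<in>U. b l * cnj (b m) * (w ^ l * cnj (w ^ m)))"
    by (intro sum.cong refl sum.swap)
  also have "\<dots> = (\<Sum>l\<le>d. \<Sum>m\<le>d. b l * cnj (b m) * (if l = m then of_nat n else 0))"
    by (intro sum.cong refl, subst sum_distrib_left[symmetric], subst o) auto
  also have "\<dots> = (\<Sum>l\<le>d. b l * cnj (b l) * of_nat n)"
    by (intro sum.cong refl) (simp add: if_distrib cong: if_cong)
  also have "\<dots> = complex_of_real (n * (\<Sum>l\<le>d. (cmod (b l))\<^sup>2))"
    unfolding of_real_mult of_real_sum complex_norm_square sum_distrib_left by (simp add: mult.commute)
  finally show ?thesis unfolding U_def of_real_eq_iff .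
qed

section \<open>A discrete Jensen inequality\<close>

text \<open>
  Jensen's formula reads: the geometric mean of \<open>\<bar>p\<bar>\<close> over \<open>\<bar>w\<bar> = r\<close> is
  \<open>M = \<bar>a\<bar> \<Prod> max(r, \<bar>z\<^sub>i\<bar>)\<close>. Only \<open>M \<le> G\<close> is wanted, and the finite products suffice: a root \<open>z\<close>
  contributes \<open>\<bar>r^n - z^n\<bar>\<close> to the product over the \<open>n\<close>-th roots of unity, which is at least
  \<open>max(r, \<bar>z\<bar>)^n\<close> up to a positive constant that does not depend on \<open>n\<close>, provided that \<open>\<bar>z\<bar> \<noteq> r\<close>. Thus
  \<open>M^n C \<le> G^n\<close> for all large \<open>n\<close>, which forces \<open>M \<le> G\<close>. Finally \<open>max(r, \<bar>z\<^sub>i\<bar>)\<close> is bounded below by \<open>r\<close> for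
  the selected roots \<open>i \<in> I\<close> and by \<open>\<bar>z\<^sub>i\<bar>\<close> for the others.
\<close>

lemma discrete_jensen:
  fixes p :: "complex poly" and z :: "'a \<Rightarrow> complex"
  assumes J: "finite J" and ev: "\<And>x. poly p x = a * (\<Prod>i\<in>J. x - z i)"
    and a0: "a \<noteq> 0" and I: "I \<subseteq> J" and r: "r > 0"
    and off: "\<And>i. i \<in> J \<Longrightarrow> cmod (z i) \<noteq> r"
    and G: "0 \<le> G"
    and le: "\<And>n. d < n \<Longrightarrow> (\<Prod>w | w ^ n = 1. cmod (poly p (of_real r * w))) \<le> G ^ n"
  shows "cmod (poly p 0) * r ^ card I \<le> G * (\<Prod>i\<in>I. cmod (z i))"
proof -
  define hi lo where "hi = (\<lambda>i. max r (cmod (z i)))" and "lo = (\<lambda>i. min r (cmod (z i)))"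
  define M where "M = cmod a * (\<Prod>i\<in>J. hi i)"
  \<comment> \<open>The constant lost: \<open>1 - q^n \<ge> 1 - q\<close> for the ratio \<open>q < 1\<close> of the smaller to the larger modulus.\<close>
  define C where "C = (\<Prod>i\<in>J. 1 - lo i / hi i)"
  have hi: "0 < hi i" "0 \<le> lo i" "lo i \<le> hi i" for i using r by (auto simp: hi_def lo_def)
  have C0: "C > 0"
    unfolding C_def
  proof (rule prod_pos)
    fix i assume "i \<in> J"
    then have "lo i < hi i"
      using off[of i] r by (auto simp: hi_def lo_def)
    then show "0 < 1 - lo i / hi i" using hi[of i] by simp
  qed
  have M0: "M > 0"
    unfolding M_def using a0 hi by (auto intro!: mult_pos_pos prod_pos)
  have key: "M ^ n * C \<le> G ^ n" if n: "d < n" for n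
  proof -
    have n0: "n > 0" using n by simp
    have one: "cmod (\<Prod>w | w ^ n = 1. of_real r * w - x) = cmod (x ^ n - of_real r ^ n)" for x
    proof -
      have "(\<Prod>w | w ^ n = 1. of_real r * w - x) = (\<Prod>w | w ^ n = 1. (- of_real r) * (x / of_real r - w))"
        using r by (intro prod.cong refl) (simp add: field_simps)
      also have "\<dots> = (- of_real r) ^ n * ((x / of_real r) ^ n - 1)"
        unfolding prod.distrib prod_minus_roots_of_unity[OF n0] using n0 by (simp add: card_roots_unity_eq)
      also have "cmod \<dots> = cmod (of_real r ^ n * ((x / of_real r) ^ n - 1))"
        by (simp add: norm_mult norm_power)
      also have "of_real r ^ n * ((x / of_real r) ^ n - 1) = x ^ n - of_real r ^ n"
        using r by (simp add: field_simps)
      finally show ?thesis .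
    qed
    have low: "hi i ^ n * (1 - lo i / hi i) \<le> cmod (\<Prod>w | w ^ n = 1. of_real r * w - z i)" for i
    proof -
      have "(lo i / hi i) ^ n \<le> (lo i / hi i) ^ 1" 
        using n0 hi[of i] by (intro power_decreasing) auto
      then have "hi i ^ n * (1 - lo i / hi i) \<le> hi i ^ n * (1 - (lo i / hi i) ^ n)"
        using hi[of i] by (intro mult_left_mono) auto
      also have "\<dots> = hi i ^ n - lo i ^ n" using hi[of i] by (simp add: field_simps)
      also have "\<dots> \<le> \<bar>cmod (z i) ^ n - r ^ n\<bar>" by (auto simp: hi_def lo_def max_def min_def)
      also have "\<dots> \<le> cmod (z i ^ n - of_real r ^ n)"
        using norm_triangle_ineq3[of "z i ^ n" "of_real r ^ n"] r by (simp add: norm_power)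
      finally show ?thesis unfolding one .
    qed
    have low_nonneg: "0 \<le> hi i ^ n * (1 - lo i / hi i)" for i
      using hi[of i] by (intro mult_nonneg_nonneg) auto
    have "M ^ n * C = cmod a ^ n * (\<Prod>i\<in>J. hi i ^ n * (1 - lo i / hi i))"
      by (simp add: M_def C_def power_mult_distrib prod.distrib prod_power_distrib)
    also have "\<dots> \<le> cmod a ^ n * (\<Prod>i\<in>J. cmod (\<Prod>w | w ^ n = 1. of_real r * w - z i))"
      using low low_nonneg by (intro mult_left_mono prod_mono) auto
    also have "\<dots> = (\<Prod>w | w ^ n = 1. cmod (poly p (of_real r * w)))"
      unfolding ev norm_mult prod_norm[symmetric] prod.distrib
      using n0 by (subst (2) prod.swap) (simp add: card_roots_unity_eq)
    also have "\<dots> \<le> G ^ n" by (rule le[OF n])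
    finally show ?thesis .
  qed
  have "M \<le> G"
  proof (rule ccontr)
    assume "\<not> M \<le> G"
    then have "G / M < 1" "0 \<le> G / M" using M0 G by auto
    then have "(\<lambda>n. (G / M) ^ n) \<longlonglongrightarrow> 0" by (intro LIMSEQ_realpow_zero) auto
    then have "\<forall>\<^sub>F n in sequentially. (G / M) ^ n < C" using C0 by (rule order_tendstoD)
    moreover have "\<forall>\<^sub>F n in sequentially. d < n" by (rule eventually_gt_at_top)
    ultimately have "\<forall>\<^sub>F n in sequentially. (G / M) ^ n < C \<and> d < n" by eventually_elim simp
    then obtain n where n: "(G / M) ^ n < C" "d < n" by (auto dest: eventually_happens)
    with key[of n] M0 show False by (simp add: field_simps power_divide)
  qed
  have split: "prod g J = prod g (J - I) * prod g I" for g :: "'a \<Rightarrow> real"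
    using I J by (rule prod.subset_diff)
  have "cmod (poly p 0) * r ^ card I = cmod a * ((\<Prod>i\<in>J - I. cmod (z i)) * (\<Prod>i\<in>I. r)) * (\<Prod>i\<in>I. cmod (z i))"
    unfolding ev norm_mult prod_norm[symmetric] split by simp
  also have "\<dots> \<le> cmod a * ((\<Prod>i\<in>J - I. hi i) * (\<Prod>i\<in>I. hi i)) * (\<Prod>i\<in>I. cmod (z i))"
    using r hi by (intro mult_right_mono mult_left_mono mult_mono prod_mono)
      (auto intro!: prod_nonneg simp: hi_def less_imp_le)
  also have "\<dots> = M * (\<Prod>i\<in>I. cmod (z i))" by (simp add: M_def split)
  also have "\<dots> \<le> G * (\<Prod>i\<in>I. cmod (z i))"
    using \<open>M \<le> G\<close> by (intro mult_right_mono prod_nonneg) auto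
  finally show ?thesis .
qed

text \<open>
  The bound extends by continuity to the finitely many radii on which roots of \<open>p\<close> lie.
\<close>

lemma root_product_bound:
  fixes p :: "complex poly" and z :: "'a \<Rightarrow> complex" and G :: "real \<Rightarrow> real"
  assumes J: "finite J" and ev: "\<And>x. poly p x = a * (\<Prod>i\<in>J. x - z i)"
    and a0: "a \<noteq> 0" and I: "I \<subseteq> J" and r: "r > 0"
    and G: "\<And>s. 0 \<le> G s" and cont: "isCont G r"
    and le: "\<And>s n. s > 0 \<Longrightarrow> d < n \<Longrightarrow> (\<Prod>w | w ^ n = 1. cmod (poly p (of_real s * w))) \<le> G s ^ n"
  shows "cmod (poly p 0) * r ^ card I \<le> G r * (\<Prod>i\<in>I. cmod (z i))"
proof (rule tendsto_le)
  show "((\<lambda>s. G s * (\<Prod>i\<in>I. cmod (z i))) \<longlongrightarrow> G r * (\<Prod>i\<in>I. cmod (z i))) (at r)"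
    using cont by (intro tendsto_intros) (simp add: isCont_def)
  show "((\<lambda>s. cmod (poly p 0) * s ^ card I) \<longlongrightarrow> cmod (poly p 0) * r ^ card I) (at r)"
    by (intro tendsto_intros)
  have "finite ((\<lambda>i. cmod (z i)) ` J)" using J by simp
  then have "\<forall>\<^sub>F s in at r. s \<notin> (\<lambda>i. cmod (z i)) ` J"
    by (metis islimpt_finite islimpt_conv_frequently_at not_frequently)
  moreover have "\<forall>\<^sub>F s in at r. s > 0"
    using r by (rule order_tendstoD(1)[OF tendsto_ident_at])
  ultimately show "\<forall>\<^sub>F s in at r. cmod (poly p 0) * s ^ card I \<le> G s * (\<Prod>i\<in>I. cmod (z i))"
  proof eventually_elim
    case (elim s)
    then show ?case by (intro discrete_jensen[OF J ev a0 I _ _ G le]) auto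
  qed
qed simp

section \<open>Hadamard's inequality\<close>

text \<open>
  The real inner product of complex vectors is only the real part of this hermitian form, and does
  not detect complex orthogonality.
\<close>

definition herm :: "complex^'n \<Rightarrow> complex^'n \<Rightarrow> complex" where
  "herm x y = (\<Sum>j\<in>UNIV. x $ j * cnj (y $ j))"

lemma herm_diff_left: "herm (x - y) z = herm x z - herm y z"
  by (simp add: herm_def algebra_simps sum_subtractf)

lemma herm_sum_scale_left: "herm (\<Sum>l\<in>S. c l *s v l) z = (\<Sum>l\<in>S. c l * herm (v l) z)"
proof -
  have "herm (\<Sum>l\<in>S. c l *s v l) z = (\<Sum>j\<in>UNIV. \<Sum>l\<in>S. c l * (v l $ j * cnj (z $ j)))"
    by (simp add: herm_def sum_distrib_right mult.assoc)
  also have "\<dots> = (\<Sum>l\<in>S. \<Sum>j\<in>UNIV. c l * (v l $ j * cnj (z $ j)))" by (rule sum.swap)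
  finally show ?thesis by (simp add: herm_def sum_distrib_left)
qed

lemma herm_commute: "herm y x = cnj (herm x y)"
  by (simp add: herm_def mult.commute)

lemma herm_self: "herm x x = of_real (\<Sum>j\<in>UNIV. (cmod (x $ j))\<^sup>2)"
  by (simp only: herm_def of_real_sum complex_norm_square)

lemma herm_pythagoras:
  assumes "herm v u = 0"
  shows "(\<Sum>j\<in>UNIV. (cmod (v $ j))\<^sup>2) \<le> (\<Sum>j\<in>UNIV. (cmod ((v + u) $ j))\<^sup>2)"
proof -
  have uv: "herm u v = 0" using assms herm_commute[of u v] by simp
  have "herm (v + u) (v + u) = herm v v + herm v u + herm u v + herm u u"
    by (simp add: herm_def algebra_simps sum.distrib)
  then have "complex_of_real (\<Sum>j\<in>UNIV. (cmod ((v + u) $ j))\<^sup>2)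
     = of_real ((\<Sum>j\<in>UNIV. (cmod (v $ j))\<^sup>2) + (\<Sum>j\<in>UNIV. (cmod (u $ j))\<^sup>2))"
    by (simp only: assms uv herm_self[symmetric] of_real_add add_0_right)
  then show ?thesis unfolding of_real_eq_iff by (simp add: sum_nonneg)
qed

text \<open>
  One row at a time, subtract its projection onto the span of the rows already orthogonalized. This
  is a row operation, so the determinant is unchanged, and by Pythagoras no row gets longer. Rows
  that have become zero need no special treatment: the coefficient \<open>c l\<close> is then \<open>0 / 0 = 0\<close>.
\<close>

lemma gram_schmidt_rows:
  fixes X :: "complex^'n^'n"
  assumes "finite S"
  shows "\<exists>Y. det Y = det X
     \<and> (\<forall>i. (\<Sum>j\<in>UNIV. (cmod (Y $ i $ j))\<^sup>2) \<le> (\<Sum>j\<in>UNIV. (cmod (X $ i $ j))\<^sup>2))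
     \<and> (\<forall>i\<in>S. \<forall>j\<in>S. i \<noteq> j \<longrightarrow> herm (Y $ i) (Y $ j) = 0)"
  using assms
proof (induction S)
  case empty
  then show ?case by auto
next
  case (insert i S)
  then obtain Y where Y: "det Y = det X"
    "\<And>i. (\<Sum>j\<in>UNIV. (cmod (Y $ i $ j))\<^sup>2) \<le> (\<Sum>j\<in>UNIV. (cmod (X $ i $ j))\<^sup>2)"
    "\<And>i j. i \<in> S \<Longrightarrow> j \<in> S \<Longrightarrow> i \<noteq> j \<Longrightarrow> herm (Y $ i) (Y $ j) = 0" by blast
  define c where "c l = herm (Y $ i) (Y $ l) / herm (Y $ l) (Y $ l)" for l
  define u where "u = (\<Sum>l\<in>S. c l *s Y $ l)"
  define v where "v = Y $ i - u"
  define Y' where "Y' = (\<chi> k. if k = i then v else Y $ k)"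
  have vj: "herm v (Y $ j) = 0" if j: "j \<in> S" for j
  proof -
    have "herm u (Y $ j) = (\<Sum>l\<in>S. if l = j then c j * herm (Y $ j) (Y $ j) else 0)"
      unfolding u_def herm_sum_scale_left using Y(3) j by (intro sum.cong) auto
    also have "\<dots> = c j * herm (Y $ j) (Y $ j)" using insert.hyps j by simp
    also have "\<dots> = herm (Y $ i) (Y $ j)"
    proof (cases "herm (Y $ j) (Y $ j) = 0")
      case True
      then have "(\<Sum>l\<in>UNIV. (cmod (Y $ j $ l))\<^sup>2) = 0" by (simp only: herm_self of_real_eq_0_iff)
      then have "Y $ j $ l = 0" for l by (simp add: sum_nonneg_eq_0_iff)
      then show ?thesis using True by (simp add: herm_def)
    qed (simp add: c_def)
    finally show ?thesis by (simp add: v_def herm_diff_left)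
  qed
  have "herm v u = cnj (herm u v)" by (rule herm_commute)
  also have "herm u v = (\<Sum>l\<in>S. c l * herm (Y $ l) v)" unfolding u_def by (rule herm_sum_scale_left)
  also have "\<dots> = 0" 
  proof (rule sum.neutral, rule ballI)
    fix l assume "l \<in> S"
    then show "c l * herm (Y $ l) v = 0" using vj[of l] herm_commute[of "Y $ l" v] by simp
  qed
  finally have vu: "herm v u = 0" by simp
  have "- u \<in> vec.span {row j Y |j. j \<noteq> i}"
    unfolding u_def using insert.hyps
    by (intro vec.span_neg vec.span_sum vec.span_scale vec.span_base) (auto simp: row_def)
  then have "det (\<chi> k. if k = i then row i Y + (- u) else row k Y) = det Y"
    by (rule det_row_span)
  also have "(\<chi> k. if k = i then row i Y + (- u) else row k Y) = Y'"
    by (simp add: vec_eq_iff Y'_def v_def row_def)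
  finally have "det Y' = det X" using Y(1) by simp
  moreover have "(\<Sum>j\<in>UNIV. (cmod (Y' $ k $ j))\<^sup>2) \<le> (\<Sum>j\<in>UNIV. (cmod (X $ k $ j))\<^sup>2)" for k
    using herm_pythagoras[OF vu] Y(2)[of k] by (auto simp: Y'_def v_def intro: order_trans)
  moreover have "herm (Y' $ k) (Y' $ j) = 0" if "k \<in> insert i S" "j \<in> insert i S" "k \<noteq> j" for k j
    using that insert.hyps Y(3)[of k j] vj[of k] vj[of j] herm_commute[of v "Y $ k"]
    by (auto simp: Y'_def)
  ultimately show ?case by blast
qed

lemma det_cnj: "det (\<chi> i j. cnj (Y $ i $ j)) = cnj (det Y)"
  by (simp add: det_def)

text \<open>
  For orthogonal rows, \<open>Y\<close> times its conjugate transpose is diagonal, with the squared row lengths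
  on the diagonal, and its determinant is \<open>\<bar>det Y\<bar>\<^sup>2\<close>. Orthogonalization reduces to this case.
\<close>

lemma hadamard_inequality:
  fixes X :: "complex^'n^'n"
  shows "(cmod (det X))\<^sup>2 \<le> (\<Prod>i\<in>UNIV. \<Sum>j\<in>UNIV. (cmod (X $ i $ j))\<^sup>2)"
proof -
  obtain Y where Y: "det Y = det X"
    "\<And>i. (\<Sum>j\<in>UNIV. (cmod (Y $ i $ j))\<^sup>2) \<le> (\<Sum>j\<in>UNIV. (cmod (X $ i $ j))\<^sup>2)"
    "\<And>i j. i \<noteq> j \<Longrightarrow> herm (Y $ i) (Y $ j) = 0"
    using gram_schmidt_rows[of UNIV X] by auto
  define H where "H = Y ** transpose (\<chi> i j. cnj (Y $ i $ j))"
  have H: "H $ i $ j = herm (Y $ i) (Y $ j)" for i j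
    by (simp add: H_def matrix_matrix_mult_def transpose_def herm_def)
  have "complex_of_real ((cmod (det X))\<^sup>2) = det H"
    unfolding complex_norm_square H_def det_mul det_transpose det_cnj Y(1) ..
  also have "\<dots> = (\<Prod>i\<in>UNIV. H $ i $ i)" by (rule det_diagonal) (simp add: H Y(3))
  also have "\<dots> = of_real (\<Prod>i\<in>UNIV. \<Sum>j\<in>UNIV. (cmod (Y $ i $ j))\<^sup>2)"
    unfolding H herm_self of_real_prod ..
  finally have "(cmod (det X))\<^sup>2 = (\<Prod>i\<in>UNIV. \<Sum>j\<in>UNIV. (cmod (Y $ i $ j))\<^sup>2)"
    unfolding of_real_eq_iff .
  also have "\<dots> \<le> (\<Prod>i\<in>UNIV. \<Sum>j\<in>UNIV. (cmod (X $ i $ j))\<^sup>2)"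
    by (intro prod_mono conjI Y(2) sum_nonneg) simp
  finally show ?thesis .
qed

section \<open>Determinants of matrix polynomials on circles\<close>

text \<open>
  The normalized Frobenius norm satisfies (A1): its square is the mean of the squared row lengths,
  which dominates their geometric mean.
\<close>

lemma det_le_norm_nF:
  fixes X :: "complex^'n^'n"
  shows "(cmod (det X))\<^sup>2 \<le> ((norm_nF X)\<^sup>2) ^ CARD('n)"
proof -
  have "(cmod (det X))\<^sup>2 \<le> (\<Prod>i\<in>UNIV. \<Sum>j\<in>UNIV. (cmod (X $ i $ j))\<^sup>2)"
    by (rule hadamard_inequality)
  also have "\<dots> \<le> ((\<Sum>i\<in>UNIV. \<Sum>j\<in>UNIV. (cmod (X $ i $ j))\<^sup>2) / CARD('n)) ^ CARD('n)"
    by (rule prod_le_mean_power) (auto intro!: sum_nonneg)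
  also have "(\<Sum>i\<in>UNIV. \<Sum>j\<in>UNIV. (cmod (X $ i $ j))\<^sup>2) / CARD('n) = (norm_nF X)\<^sup>2"
    by (simp add: norm_nF_def sum_nonneg)
  finally show ?thesis .
qed

definition matpoly_at :: "(nat \<Rightarrow> complex^'n^'n) \<Rightarrow> nat \<Rightarrow> complex \<Rightarrow> complex^'n^'n" where
  "matpoly_at A d z = (\<Sum>l\<le>d. \<chi> i j. z ^ l * A l $ i $ j)"

lemma matpoly_at_nth: "matpoly_at A d z $ i $ j = (\<Sum>l\<le>d. A l $ i $ j * z ^ l)"
  by (simp add: matpoly_at_def mult.commute)

lemma poly_det_matpoly: "poly (det (matpoly A d)) z = det (matpoly_at A d z)"
  by (simp add: det_def poly_sum poly_prod matpoly_def poly_monom matpoly_at_nth)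

lemma matpoly_at_0: "matpoly_at A d 0 = A 0"
proof -
  have "(\<Sum>l\<le>d. A l $ i $ j * 0 ^ l) = (\<Sum>l\<in>{0}. A l $ i $ j * 0 ^ l)" for i j
    by (rule sum.mono_neutral_right) (auto simp: zero_power)
  then show ?thesis by (simp add: vec_eq_iff matpoly_at_nth)
qed

lemma matpoly_at_sandwich:
  fixes A :: "nat \<Rightarrow> complex^'n^'n" and Q Q' :: "complex^'n^'n"
  shows "Q ** matpoly_at A d z ** Q' = matpoly_at (\<lambda>l. Q ** A l ** Q') d z"
proof -
  have s: "Q ** (\<chi> i j. c * X $ i $ j) ** Q' = (\<chi> i j. c * (Q ** X ** Q') $ i $ j)" for c X
    by (simp add: vec_eq_iff matrix_matrix_mult_def sum_distrib_left sum_distrib_right mult_ac)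
  have radd: "(X + Y) ** Z = X ** Z + Y ** Z" for X Y Z :: "complex^'n^'n"
    by (simp add: vec_eq_iff matrix_matrix_mult_def sum.distrib distrib_right)
  show ?thesis
    unfolding matpoly_at_def
  proof (induction d)
    case 0
    then show ?case using s[of 1] by simp
  next
    case (Suc d)
    then show ?case unfolding sum.atMost_Suc matrix_add_ldistrib radd s by simp
  qed
qed

lemma norm_matpoly_at_le:
  assumes "is_matrix_space_norm N"
  shows "N (matpoly_at A d z) \<le> (\<Sum>l\<le>d. N (A l) * cmod z ^ l)"
proof -
  have s: "N (\<chi> i j. c * X $ i $ j) = cmod c * N X" and t: "N (X + Y) \<le> N X + N Y" for c X Y
    using assms unfolding is_matrix_space_norm_def by blast+
  show ?thesis
    unfolding matpoly_at_def
  proof (induction d)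
    case 0
    then show ?case by simp
  next
    case (Suc d)
    then show ?case
      unfolding sum.atMost_Suc
      by (intro order_trans[OF t] add_mono) (simp_all only: s norm_power mult.commute order_refl)
  qed
qed

text \<open>
  Parseval's identity in each entry: the mean of \<open>\<parallel>P(z)\<parallel>\<^sub>n\<^sub>F\<^sup>2\<close> over the circle of radius \<open>s\<close>.
\<close>

lemma sum_norm_nF_matpoly_at:
  assumes "d < n"
  shows "(\<Sum>w | w ^ n = 1. (norm_nF (matpoly_at B d (of_real s * w)))\<^sup>2)
    = n * (\<Sum>l\<le>d. (norm_nF (B l))\<^sup>2 * (s\<^sup>2) ^ l)"
proof -
  let ?U = "{w. w ^ n = (1 :: complex)}"
  define K where "K = 1 / real CARD('a)"
  have nF: "(norm_nF X)\<^sup>2 = K * (\<Sum>i\<in>UNIV. \<Sum>j\<in>UNIV. (cmod (X $ i $ j))\<^sup>2)" for X :: "complex^'a^'a"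
    by (simp add: norm_nF_def sum_nonneg K_def)
  have ent: "(\<Sum>w\<in>?U. (cmod (matpoly_at B d (of_real s * w) $ i $ j))\<^sup>2)
      = (\<Sum>l\<le>d. n * ((cmod (B l $ i $ j))\<^sup>2 * (s\<^sup>2) ^ l))" for i j
  proof -
    have "(\<Sum>w\<in>?U. (cmod (matpoly_at B d (of_real s * w) $ i $ j))\<^sup>2)
      = (\<Sum>w\<in>?U. (cmod (\<Sum>l\<le>d. (B l $ i $ j * of_real s ^ l) * w ^ l))\<^sup>2)"
      by (simp add: matpoly_at_nth power_mult_distrib mult.assoc)
    also have "\<dots> = n * (\<Sum>l\<le>d. (cmod (B l $ i $ j * of_real s ^ l))\<^sup>2)"
      using assms by (rule parseval_roots_of_unity)
    also have "\<dots> = (\<Sum>l\<le>d. n * ((cmod (B l $ i $ j))\<^sup>2 * (s\<^sup>2) ^ l))"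
    proof -
      have "(cmod (of_real s ^ l))\<^sup>2 = (s\<^sup>2) ^ l" for l
        by (metis norm_power of_real_power norm_of_real power2_abs power_mult mult.commute)
      then show ?thesis by (simp only: sum_distrib_left norm_mult power_mult_distrib)
    qed
    finally show ?thesis .
  qed
  have "(\<Sum>w\<in>?U. (norm_nF (matpoly_at B d (of_real s * w)))\<^sup>2)
      = K * (\<Sum>w\<in>?U. \<Sum>i\<in>UNIV. \<Sum>j\<in>UNIV. (cmod (matpoly_at B d (of_real s * w) $ i $ j))\<^sup>2)"
    by (simp add: nF sum_distrib_left)
  also have "\<dots> = K * (\<Sum>i\<in>UNIV. \<Sum>w\<in>?U. \<Sum>j\<in>UNIV. (cmod (matpoly_at B d (of_real s * w) $ i $ j))\<^sup>2)"
    by (subst sum.swap) (rule refl)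
  also have "\<dots> = K * (\<Sum>i\<in>UNIV. \<Sum>j\<in>UNIV. \<Sum>w\<in>?U. (cmod (matpoly_at B d (of_real s * w) $ i $ j))\<^sup>2)"
    by (intro arg_cong[where f = "(*) K"] sum.cong refl sum.swap)
  also have "\<dots> = K * (\<Sum>i\<in>UNIV. \<Sum>j\<in>UNIV. \<Sum>l\<le>d. n * ((cmod (B l $ i $ j))\<^sup>2 * (s\<^sup>2) ^ l))"
    unfolding ent ..
  also have "\<dots> = K * (\<Sum>i\<in>UNIV. \<Sum>l\<le>d. \<Sum>j\<in>UNIV. n * ((cmod (B l $ i $ j))\<^sup>2 * (s\<^sup>2) ^ l))"
    by (intro arg_cong[where f = "(*) K"] sum.cong refl sum.swap)
  also have "\<dots> = K * (\<Sum>l\<le>d. \<Sum>i\<in>UNIV. \<Sum>j\<in>UNIV. n * ((cmod (B l $ i $ j))\<^sup>2 * (s\<^sup>2) ^ l))"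
    by (subst sum.swap) (rule refl)
  also have "\<dots> = n * (\<Sum>l\<le>d. (norm_nF (B l))\<^sup>2 * (s\<^sup>2) ^ l)"
    unfolding nF sum_distrib_left sum_distrib_right by (simp add: mult_ac)
  finally show ?thesis .
qed

text \<open>
  The bounds on products over roots of unity that the discrete Jensen inequality asks for. Under
  (A1) each factor is bounded separately.
\<close>

lemma prod_det_le_A1:
  fixes A :: "nat \<Rightarrow> complex^'n^'n"
  assumes N: "is_matrix_space_norm N" "cond_A1 N" and s: "0 < s" and n: "0 < n"
  shows "(\<Prod>w | w ^ n = 1. cmod (poly (det (matpoly A d)) (of_real s * w)))
     \<le> ((\<Sum>l\<le>d. N (A l) * s ^ l) ^ CARD('n)) ^ n"
proof -
  have "(\<Prod>w | w ^ n = 1. cmod (poly (det (matpoly A d)) (of_real s * w)))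
     \<le> (\<Prod>w | w ^ n = (1::complex). (\<Sum>l\<le>d. N (A l) * s ^ l) ^ CARD('n))"
  proof (intro prod_mono conjI)
    fix w assume "w \<in> {w. w ^ n = (1::complex)}"
    then have w: "cmod (of_real s * w) = s" using norm_root_of_unity[OF n] s by (simp add: norm_mult)
    have "cmod (det (matpoly_at A d (of_real s * w))) \<le> N (matpoly_at A d (of_real s * w)) ^ CARD('n)"
      using N(2) by (simp add: cond_A1_def)
    also have "\<dots> \<le> (\<Sum>l\<le>d. N (A l) * s ^ l) ^ CARD('n)"
      using norm_matpoly_at_le[OF N(1), of A d "of_real s * w"] N(1)
      by (intro power_mono) (simp_all add: w is_matrix_space_norm_def)
    finally show "cmod (poly (det (matpoly A d)) (of_real s * w)) \<le> (\<Sum>l\<le>d. N (A l) * s ^ l) ^ CARD('n)"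
      by (simp add: poly_det_matpoly)
  qed simp
  then show ?thesis using n by (simp add: card_roots_unity_eq)
qed

text \<open>
  Under (A2), \<open>P\<close> may be replaced by \<open>Q P Q'\<close>, which has the same determinant. Bounding the product
  of the factors by their mean is what turns the sum of norms into a sum of squares: the cross terms
  between coefficients cancel on average over the circle.
\<close>

lemma prod_det_le_A2:
  fixes A :: "nat \<Rightarrow> complex^'n^'n"
  assumes "cond_A2 N" and n: "d < n"
  shows "(\<Prod>w | w ^ n = 1. cmod (poly (det (matpoly A d)) (of_real s * w)))
     \<le> (sqrt (\<Sum>l\<le>d. (N (A l))\<^sup>2 * (s\<^sup>2) ^ l) ^ CARD('n)) ^ n"
proof (rule power2_le_imp_le)
  obtain Q Q' where Q: "det Q = 1" "det Q' = 1" "\<And>X. norm_nF (Q ** X ** Q') \<le> N X"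
    using assms(1) unfolding cond_A2_def by blast
  define B where "B l = Q ** A l ** Q'" for l
  define F where "F w = (norm_nF (matpoly_at B d (of_real s * w)))\<^sup>2" for w
  define H where "H = (\<Sum>l\<le>d. (N (A l))\<^sup>2 * (s\<^sup>2) ^ l)"
  let ?U = "{w. w ^ n = (1::complex)}"
  have H0: "0 \<le> H" by (simp add: H_def sum_nonneg)
  have n0: "0 < n" using n by simp
  have U: "finite ?U" "?U \<noteq> {}" using n0 by (auto intro: finite_nth_roots exI[of _ 1])
  have nF0: "0 \<le> norm_nF X" for X :: "complex^'n^'n" by (simp add: norm_nF_def sum_nonneg)
  have dQ: "det (matpoly_at A d z) = det (matpoly_at B d z)" for z
    using arg_cong[OF matpoly_at_sandwich[of Q A d z Q'], of det]
    unfolding B_def[abs_def] by (simp add: det_mul Q)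
  have "(\<Prod>w\<in>?U. cmod (poly (det (matpoly A d)) (of_real s * w)))\<^sup>2
      = (\<Prod>w\<in>?U. (cmod (det (matpoly_at B d (of_real s * w))))\<^sup>2)"
    by (simp add: poly_det_matpoly dQ prod_power_distrib)
  also have "\<dots> \<le> (\<Prod>w\<in>?U. F w ^ CARD('n))"
    unfolding F_def by (intro prod_mono conjI det_le_norm_nF) simp
  also have "\<dots> = (\<Prod>w\<in>?U. F w) ^ CARD('n)" by (simp add: prod_power_distrib)
  also have "\<dots> \<le> ((sum F ?U / card ?U) ^ card ?U) ^ CARD('n)"
    using U by (intro power_mono prod_le_mean_power prod_nonneg) (auto simp: F_def)
  also have "sum F ?U / card ?U = (\<Sum>l\<le>d. (norm_nF (B l))\<^sup>2 * (s\<^sup>2) ^ l)"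
    unfolding F_def sum_norm_nF_matpoly_at[OF n] using n0 by (simp add: card_roots_unity_eq)
  also have "(\<dots> ^ card ?U) ^ CARD('n) \<le> (H ^ card ?U) ^ CARD('n)"
    unfolding H_def
    by (intro power_mono sum_mono mult_right_mono)
       (auto simp: B_def Q nF0 sum_nonneg)
  also have "\<dots> = ((sqrt H ^ CARD('n)) ^ n)\<^sup>2"
  proof -
    have "((sqrt H ^ CARD('n)) ^ n)\<^sup>2 = (((sqrt H)\<^sup>2) ^ n) ^ CARD('n)"
      by (simp only: power_mult[symmetric] mult_ac)
    then show ?thesis using H0 n0 by (simp add: card_roots_unity_eq)
  qed
  finally show "(\<Prod>w\<in>?U. cmod (poly (det (matpoly A d)) (of_real s * w)))\<^sup>2
    \<le> ((sqrt (\<Sum>l\<le>d. (N (A l))\<^sup>2 * (s\<^sup>2) ^ l) ^ CARD('n)) ^ n)\<^sup>2" by (simp add: H_def)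
qed (simp add: sum_nonneg)

section \<open>Tropical roots\<close>

text \<open>
  At \<open>x = 0\<close> the factorization of the tropical polynomial gives \<open>\<parallel>A\<^sub>0\<parallel> = \<parallel>A\<^sub>d\<parallel> \<alpha>\<^sub>1 \<dots> \<alpha>\<^sub>d\<close>, hence
  positivity, as \<open>A\<^sub>0 \<noteq> 0\<close>.
  At \<open>x = \<alpha>\<^sub>j\<close> it gives \<open>\<parallel>A\<^sub>j\<parallel> \<alpha>\<^sub>j^j \<le> \<parallel>A\<^sub>d\<parallel> \<alpha>\<^sub>j^j \<alpha>\<^sub>j\<^sub>+\<^sub>1 \<dots> \<alpha>\<^sub>d\<close>, because the roots are sorted.
\<close>

lemma tropical_coeff_bounds:
  assumes d: "1 \<le> d" and N: "is_matrix_space_norm N" and A0: "A 0 \<noteq> 0"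
    and trop: "tropical_roots N A d \<alpha>"
  shows "\<And>j. j \<in> {1..d} \<Longrightarrow> 0 < \<alpha> j"
    and "\<And>j. j \<le> d \<Longrightarrow> N (A j) \<le> N (A 0) / (\<Prod>i=1..j. \<alpha> i)"
proof -
  have a0: "\<And>j. j \<in> {1..d} \<Longrightarrow> 0 \<le> \<alpha> j" and mono: "mono_on {1..d} \<alpha>"
    and eq: "\<And>x. 0 \<le> x \<Longrightarrow> trop_poly N A d x = N (A d) * (\<Prod>j=1..d. max x (\<alpha> j))"
    using trop unfolding tropical_roots_def by blast+
  have N0: "0 \<le> N X" "N X = 0 \<longleftrightarrow> X = 0" for X using N by (auto simp: is_matrix_space_norm_def)
  have le: "N (A j) * x ^ j \<le> N (A d) * (\<Prod>j=1..d. max x (\<alpha> j))" if "0 \<le> x" "j \<le> d" for x j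
    unfolding eq[OF that(1), symmetric] trop_poly_def using that by (intro Max_ge) auto
  have "trop_poly N A d 0 = N (A 0)"
    unfolding trop_poly_def
  proof (rule Max_eqI)
    show "N (A 0) \<in> (\<lambda>j. N (A j) * 0 ^ j) ` {0..d}" by (auto intro: image_eqI[of _ _ 0])
  qed (auto simp: power_0_left N0)
  moreover have "(\<Prod>j=1..d. max 0 (\<alpha> j)) = (\<Prod>j=1..d. \<alpha> j)"
    using a0 by (intro prod.cong) auto
  ultimately have NA0: "N (A 0) = N (A d) * (\<Prod>j=1..d. \<alpha> j)" using eq[of 0] by simp
  have "N (A 0) \<noteq> 0" using A0 N0 by simp
  then have "(\<Prod>j=1..d. \<alpha> j) \<noteq> 0" unfolding NA0 by simp
  then show pos: "0 < \<alpha> j" if "j \<in> {1..d}" for j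
    using that a0[of j] by (auto simp: less_le)
  show "N (A j) \<le> N (A 0) / (\<Prod>i=1..j. \<alpha> i)" if j: "j \<le> d" for j
  proof (cases "j = 0")
    case False
    then have aj: "0 < \<alpha> j" using pos j by simp
    define T where "T = (\<Prod>i=Suc j..d. \<alpha> i)"
    have split: "(\<Prod>i=1..d. g i) = (\<Prod>i=1..j. g i) * (\<Prod>i=Suc j..d. g i)" for g :: "nat \<Rightarrow> real"
      using prod.ub_add_nat[of 1 j g "d - j"] j by simp
    have "(\<Prod>i=1..j. max (\<alpha> j) (\<alpha> i)) = (\<Prod>i=1..j. \<alpha> j)"
      using mono j by (intro prod.cong refl max_absorb1) (auto simp: mono_on_def)
    moreover have "(\<Prod>i=Suc j..d. max (\<alpha> j) (\<alpha> i)) = T"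
      unfolding T_def using mono j False by (intro prod.cong refl max_absorb2) (auto simp: mono_on_def)
    ultimately have "(\<Prod>i=1..d. max (\<alpha> j) (\<alpha> i)) = \<alpha> j ^ j * T" unfolding split by simp
    then have "N (A j) * \<alpha> j ^ j \<le> (N (A d) * T) * \<alpha> j ^ j"
      using le[of "\<alpha> j" j] aj j by (simp add: mult_ac)
    then have "N (A j) \<le> N (A d) * T" using aj by simp
    also have "\<dots> = N (A 0) / (\<Prod>i=1..j. \<alpha> i)"
    proof -
      have "(\<Prod>i=1..j. \<alpha> i) > 0" using pos j by (intro prod_pos) auto
      then show ?thesis unfolding NA0 split T_def[symmetric] by (simp only: field_simps)
    qed
    finally show ?thesis .
  qed simp
qed

text \<open>
  The next two lemmas compare a sum whose terms decay at least geometrically away from one end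
  with the geometric series.
\<close>

lemma sum_below_le:
  fixes w :: "nat \<Rightarrow> real"
  assumes "0 \<le> q" "q < 1" "0 \<le> w 0" "\<And>j. j < m \<Longrightarrow> w j \<le> q * w (Suc j)"
  shows "(\<Sum>j\<le>m. w j) \<le> w m / (1 - q)"
  using assms(4)
proof (induction m)
  case 0
  have "w 0 * (1 - q) \<le> w 0" using assms by (intro mult_left_le) auto
  then show ?case using assms by (simp add: field_simps)
next
  case (Suc m)
  have "(\<Sum>j\<le>Suc m. w j) \<le> w m / (1 - q) + w (Suc m)" using Suc by simp
  also have "\<dots> \<le> q * w (Suc m) / (1 - q) + w (Suc m)"
    using Suc.prems[of m] assms by (simp add: divide_right_mono)
  also have "\<dots> = w (Suc m) / (1 - q)" using assms by (simp add: field_simps)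
  finally show ?case .
qed

lemma sum_above_le:
  fixes w :: "nat \<Rightarrow> real"
  assumes "0 \<le> q" "q < 1" "\<And>j. j \<le> m \<Longrightarrow> 0 \<le> w j" "\<And>j. j < m \<Longrightarrow> w (Suc j) \<le> q * w j"
  shows "(\<Sum>j\<le>m. w j) \<le> w 0 / (1 - q)"
proof -
  have "(\<Sum>j\<le>m. w (m - j)) \<le> w (m - m) / (1 - q)"
  proof (rule sum_below_le)
    fix j assume "j < m"
    then show "w (m - j) \<le> q * w (m - Suc j)" using assms(4)[of "m - Suc j"] by (simp add: Suc_diff_Suc)
  qed (use assms in auto)
  also have "(\<Sum>j\<le>m. w (m - j)) = (\<Sum>j\<le>m. w j)"
    using sum.atLeastAtMost_rev[of w 0 m] by (simp add: atLeast0AtMost)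
  finally show ?thesis by simp
qed

text \<open>
  All terms at \<open>r = \<beta>\<^sub>k t\<close> are compared with the one of index \<open>k\<close>. Passing from \<open>j\<close> to \<open>j + 1\<close> multiplies a term by
  \<open>r / \<beta>\<^sub>j\<^sub>+\<^sub>1\<close>, so above \<open>k\<close> the ratio is at most \<open>r / \<beta>\<^sub>k\<^sub>+\<^sub>1 = p t\<close>. Going down, the first step from \<open>k\<close> to
  \<open>k - 1\<close> divides by exactly \<open>t\<close>, and the later ones by at least \<open>r / \<beta>\<^sub>k\<^sub>-\<^sub>1 = t / m\<close>; the terms below \<open>k\<close> thus
  contribute \<open>(1/t) / (1 - m/t) = 1/(t - m)\<close>. The statement is in terms of a general sequence because it
  is needed for the tropical roots and for their squares.
\<close>

lemma sum_at_tropical_root: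
  fixes \<beta> :: "nat \<Rightarrow> real"
  assumes pos: "\<And>j. j \<in> {1..d} \<Longrightarrow> 0 < \<beta> j" and mono: "mono_on {1..d} \<beta>" and b0: "\<beta> 0 = 0"
    and k: "k \<in> {1..d}" and m: "m = \<beta> (k - 1) / \<beta> k"
    and p: "p = (if k = d then 0 else \<beta> k / \<beta> (k + 1))"
    and t: "m < t" "p * t < 1"
  shows "(\<Sum>j\<le>d. (\<beta> k * t) ^ j / (\<Prod>i=1..j. \<beta> i))
     \<le> (\<beta> k * t) ^ k / (\<Prod>i=1..k. \<beta> i) * (1 / (1 - p * t) + 1 / (t - m))"
proof -
  define r where "r = \<beta> k * t"
  define w where "w j = r ^ j / (\<Prod>i=1..j. \<beta> i)" for j
  have le: "\<beta> i \<le> \<beta> j" if "1 \<le> i" "i \<le> j" "j \<le> d" for i j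
    using mono that by (auto simp: mono_on_def)
  have bk: "0 < \<beta> k" using pos k by auto
  have "0 \<le> \<beta> (k - 1)" using pos[of "k - 1"] k b0 by (cases "k = 1") (force intro: less_imp_le)+
  then have m0: "0 \<le> m" unfolding m using bk by simp
  have t0: "0 < t" using m0 t by simp
  have r0: "0 < r" using t0 bk by (simp add: r_def)
  have p0: "0 \<le> p" unfolding p using k pos[of k] pos[of "k + 1"] by (auto intro: less_imp_le)
  have w0: "0 < w j" if "j \<le> d" for j
    unfolding w_def using that r0 pos by (intro divide_pos_pos prod_pos zero_less_power) auto
  have step: "w (Suc j) = w j * r / \<beta> (Suc j)" for j by (simp add: w_def mult_ac)
  obtain k' where k': "k = Suc k'" using k by (cases k) auto
  have wk: "w k' = w k / t" unfolding k' step using t0 bk k' by (simp add: r_def)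
  have "(\<Sum>j\<le>k'. w j) \<le> w k' / (1 - m / t)"
  proof (rule sum_below_le)
    show "0 \<le> m / t" "m / t < 1" using m0 t0 t by auto
    show "0 \<le> w 0" by (simp add: w_def)
    fix j assume j: "j < k'"
    have bj: "0 < \<beta> (Suc j)" using pos j k k' by auto
    have "w j = w (Suc j) * \<beta> (Suc j) / r" using r0 bj unfolding step by simp
    also have "\<dots> \<le> w (Suc j) * \<beta> k' / r"
      using le[of "Suc j" k'] j k k' r0 w0[of "Suc j"]
      by (intro divide_right_mono mult_left_mono) auto
    also have "\<dots> = m / t * w (Suc j)" using bk by (simp add: m k' r_def)
    finally show "w j \<le> m / t * w (Suc j)" .
  qed
  also have "\<dots> = w k * (1 / (t - m))" unfolding wk using t0 t by (simp add: field_simps)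
  finally have below: "(\<Sum>j\<le>k'. w j) \<le> w k * (1 / (t - m))" .
  have "(\<Sum>j\<le>d - k. w (k + j)) \<le> w (k + 0) / (1 - p * t)"
  proof (rule sum_above_le)
    show "0 \<le> p * t" "p * t < 1" using p0 t0 t by auto
    fix j
    show "0 \<le> w (k + j)" if "j \<le> d - k" using that k by (intro less_imp_le[OF w0]) auto
    assume j: "j < d - k"
    then have p': "p = \<beta> k / \<beta> (Suc k)" and kd: "k < d" by (auto simp: p)
    have b: "0 < \<beta> (Suc k)" "0 < \<beta> (Suc (k + j))" using pos j k by auto
    have "w (k + Suc j) = w (k + j) * r / \<beta> (Suc (k + j))" by (simp add: step)
    also have "\<dots> \<le> w (k + j) * r / \<beta> (Suc k)"
      using le[of "Suc k" "Suc (k + j)"] j b r0 w0[of "k + j"]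
      by (intro divide_left_mono mult_nonneg_nonneg) (auto simp: less_imp_le)
    also have "\<dots> = p * t * w (k + j)" by (simp add: p' r_def)
    finally show "w (k + Suc j) \<le> p * t * w (k + j)" .
  qed
  then have above: "(\<Sum>j=k..d. w j) \<le> w k * (1 / (1 - p * t))"
    using sum.atLeastAtMost_shift_0[of k d w] k by (simp add: atLeast0AtMost)
  have "{..d} = {..k'} \<union> {k..d}" using k k' by auto
  then have "(\<Sum>j\<le>d. w j) = (\<Sum>j\<le>k'. w j) + (\<Sum>j=k..d. w j)"
    using k' by (subst \<open>{..d} = _\<close>, intro sum.union_disjoint) auto
  also have "\<dots> \<le> w k * (1 / (1 - p * t) + 1 / (t - m))"
    using below above by (simp add: distrib_left)
  finally show ?thesis by (simp add: w_def r_def)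
qed

section \<open>The constants\<close>

text \<open>
  \<open>1 / L_sharp m p\<close> is the infimum of \<open>f(t) = 1/(1 - p t) + 1/(t - m)\<close> over the admissible \<open>t\<close>. With
  \<open>s = sqrt p\<close>, write \<open>f(t) = 1/x + s\<^sup>2/y\<close> for \<open>x = 1 - p t\<close> and \<open>y = p (t - m)\<close>. Since \<open>x + y = 1 - m p\<close> is
  constant, the minimum is \<open>(1 + s)\<^sup>2 / (1 - m p)\<close>, where \<open>y = s x\<close>. If \<open>p = 0\<close> the infimum \<open>1\<close> is
  only approached as \<open>t \<rightarrow> \<infinity>\<close>; if \<open>m p = 1\<close> no \<open>t\<close> is admissible and the constant is \<open>0\<close>.
\<close>

lemma L_sharp_le_if_bounds:
  fixes m p X :: real
  assumes "0 \<le> m" "m \<le> 1" "0 \<le> p" "p \<le> 1" "0 \<le> X"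
    and ub: "\<And>t. m < t \<Longrightarrow> p * t < 1 \<Longrightarrow> 1 \<le> X * (1 / (1 - p * t) + 1 / (t - m))"
  shows "L_sharp m p \<le> X"
proof -
  define s where "s = sqrt p"
  have s: "0 \<le> s" "s * s = p" "s \<le> 1" using assms by (auto simp: s_def)
  have mp: "m * p \<le> 1" using assms by (intro mult_le_one) auto
  consider "m * p = 1" | "p = 0" | "m * p < 1" "0 < p" using mp assms by linarith
  then show ?thesis
  proof cases
    case 1
    then show ?thesis using assms by (simp add: L_sharp_def)
  next
    case 2
    have "((\<lambda>t. X * (1 + 1 / (t - m))) \<longlongrightarrow> X * (1 + 0)) at_top"
      by (intro tendsto_intros tendsto_divide_0[OF tendsto_const] filterlim_at_top_imp_at_infinity
          filterlim_at_top_add_at_top) real_asymp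
    moreover have "\<forall>\<^sub>F t in at_top. 1 \<le> X * (1 + 1 / (t - m))"
      using eventually_gt_at_top[of m] by eventually_elim (use ub 2 in auto)
    ultimately have "1 \<le> X * (1 + 0)" by (intro tendsto_lowerbound) auto
    then show ?thesis using 2 by (simp add: L_sharp_def)
  next
    case 3
    then have s0: "s > 0" using s by (auto simp: less_eq_real_def)
    then have nz: "s \<noteq> 0" "1 + s \<noteq> 0" by auto
    \<comment> \<open>The solution of \<open>p (t - m) = s (1 - p t)\<close>.\<close>
    define t where "t = (1 + m * s) / (s * (1 + s))"
    have t1: "1 - p * t = (1 - m * p) / (1 + s)"
    proof -
      have "1 - p * t = 1 - s * (1 + m * s) / (1 + s)"
        unfolding t_def s(2)[symmetric] using nz by simp
      also have "\<dots> = (1 - m * (s * s)) / (1 + s)" using nz by (simp add: field_simps)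
      finally show ?thesis by (simp add: s(2))
    qed
    have t2: "t - m = (1 - m * p) / (s * (1 + s))"
    proof -
      have "t - m = (1 + m * s - m * (s * (1 + s))) / (s * (1 + s))"
        unfolding t_def using nz by (simp add: diff_divide_distrib)
      also have "1 + m * s - m * (s * (1 + s)) = 1 - m * (s * s)" by algebra
      finally show ?thesis by (simp add: s(2))
    qed
    have "0 < 1 - p * t" "0 < t - m" unfolding t1 t2 using s0 3 by auto
    then have "1 \<le> X * (1 / (1 - p * t) + 1 / (t - m))" by (intro ub) auto
    also have "1 / (1 - p * t) + 1 / (t - m) = (1 + s)\<^sup>2 / (1 - m * p)"
      unfolding t1 t2 using s0 3 by (simp add: power2_eq_square flip: add_divide_distrib) (simp add: algebra_simps)
    finally have "(1 - m * p) / (1 + s)\<^sup>2 \<le> X" using s0 3 by (simp add: field_simps)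
    then show ?thesis by (simp only: L_sharp_def s_def)
  qed
qed

text \<open>
  Both comparisons come from \<open>m, p \<le> 1\<close>: the first from \<open>m p \<le> p\<close>, the second from \<open>m p \<le> m\<close> and
  \<open>(1 + sqrt p)\<^sup>2 \<le> 4\<close>.
\<close>

lemma L_max_le_L_sharp:
  fixes m p :: real
  assumes "0 \<le> m" "m \<le> 1" "0 \<le> p" "p \<le> 1"
  shows "L_max m p \<le> L_sharp m p"
proof -
  define s where "s = sqrt p"
  have s: "0 \<le> s" "s * s = p" "s \<le> 1" using assms by (auto simp: s_def)
  have mp: "m * p \<le> p" "m * p \<le> m" using assms by (auto intro: mult_left_le mult_left_le_one_le)
  have "(1 - s) / (1 + s) = (1 - p) / (1 + s)\<^sup>2"
  proof -
    have "1 - p = (1 - s) * (1 + s)" unfolding s(2)[symmetric] by algebra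
    then show ?thesis using s by (simp add: power2_eq_square)
  qed
  also have "\<dots> \<le> (1 - m * p) / (1 + s)\<^sup>2" using mp by (intro divide_right_mono) auto
  finally have 1: "(1 - s) / (1 + s) \<le> (1 - m * p) / (1 + s)\<^sup>2" .
  have "(1 + s)\<^sup>2 \<le> 2\<^sup>2" using s by (intro power_mono) auto
  then have s4: "(1 + s)\<^sup>2 \<le> 4" by simp
  have "(1 - m) / (4 * (1 + m)) \<le> (1 - m * p) / (1 + s)\<^sup>2"
    using assms mp s4 s by (intro frac_le) auto
  with 1 show ?thesis by (simp add: s_def L_max_def L_sharp_def)
qed

text \<open>
  The square root of the preceding comparison at the squared ratios.
\<close>

lemma L_star_max_le_L_star_sharp:
  fixes m p :: real
  assumes "0 \<le> m" "m \<le> 1" "0 \<le> p" "p \<le> 1"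
  shows "L_star_max m p \<le> L_star_sharp m p"
proof -
  have "max ((1 - p) / (1 + p)) ((1 - m\<^sup>2) / (4 * (1 + m\<^sup>2))) \<le> (1 - m\<^sup>2 * p\<^sup>2) / (1 + p)\<^sup>2"
    using L_max_le_L_sharp[of "m\<^sup>2" "p\<^sup>2"] assms
    by (auto simp: power_le_one L_max_def L_sharp_def)
  then have "sqrt ((1 - p) / (1 + p)) \<le> sqrt ((1 - m\<^sup>2 * p\<^sup>2) / (1 + p)\<^sup>2)"
    "sqrt ((1 - m\<^sup>2) / (4 * (1 + m\<^sup>2))) \<le> sqrt ((1 - m\<^sup>2 * p\<^sup>2) / (1 + p)\<^sup>2)"
    by simp_all
  moreover have "sqrt ((1 - m\<^sup>2) / (4 * (1 + m\<^sup>2))) = 1 / 2 * sqrt ((1 - m\<^sup>2) / (1 + m\<^sup>2))"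
    by (simp only: real_sqrt_divide real_sqrt_mult) simp
  moreover have "sqrt ((1 - m\<^sup>2 * p\<^sup>2) / (1 + p)\<^sup>2) = sqrt (1 - m\<^sup>2 * p\<^sup>2) / (1 + p)"
    using assms by (simp add: real_sqrt_divide)
  ultimately show ?thesis 
    by (auto simp only: L_star_max_def L_star_sharp_def max.bounded_iff)
qed

text \<open>
  The form in which the optimization is used: the bounds available for each \<open>t\<close> carry an \<open>n\<close>-th power
  and a factor \<open>c\<close>, and taking \<open>n\<close>-th roots of \<open>Z / c\<close> reduces them to the previous setting.
\<close>

lemma L_sharp_power_le:
  assumes mp: "0 \<le> m" "m \<le> 1" "0 \<le> p" "p \<le> 1" and c: "0 \<le> c" and Z: "0 \<le> Z" and n: "0 < n"
    and ub: "\<And>t. m < t \<Longrightarrow> p * t < 1 \<Longrightarrow> c \<le> Z * (1 / (1 - p * t) + 1 / (t - m)) ^ n"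
  shows "c * L_sharp m p ^ n \<le> Z"
proof (cases "c = 0")
  case False
  then have c0: "0 < c" using c by simp
  define X where "X = root n (Z / c)"
  have X0: "0 \<le> X" using Z c n by (simp add: X_def)
  have Xn: "X ^ n = Z / c" using Z c n by (simp add: X_def)
  have mp1: "0 \<le> 1 - m * p" using mult_le_one[of m p] mp by simp
  have "L_sharp m p \<le> X"
  proof (rule L_sharp_le_if_bounds[OF mp X0])
    fix t assume t: "m < t" "p * t < 1"
    let ?f = "1 / (1 - p * t) + 1 / (t - m)"
    have "1 \<le> (X * ?f) ^ n" 
      using ub[OF t] c0 unfolding power_mult_distrib Xn by (simp only: le_divide_eq_1_pos times_divide_eq_left)
    moreover have "0 \<le> X * ?f" using X0 t by (intro mult_nonneg_nonneg add_nonneg_nonneg) auto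
    ultimately show "1 \<le> X * ?f" using n by (meson not_le power_less_one_iff)
  qed
  then have "L_sharp m p ^ n \<le> X ^ n" using mp1 by (intro power_mono) (auto simp: L_sharp_def)
  then show ?thesis using c0 by (simp add: Xn field_simps)
qed (use Z in simp)

lemma L_star_sharp_square:
  assumes "0 \<le> m" "m \<le> 1" "0 \<le> p" "p \<le> 1"
  shows "(L_star_sharp m p)\<^sup>2 = L_sharp (m\<^sup>2) (p\<^sup>2)" "0 \<le> L_star_sharp m p"
proof -
  have "m\<^sup>2 * p\<^sup>2 \<le> 1" using assms by (intro mult_le_one power_le_one) auto
  then show "(L_star_sharp m p)\<^sup>2 = L_sharp (m\<^sup>2) (p\<^sup>2)" "0 \<le> L_star_sharp m p"
    using assms by (simp_all add: L_star_sharp_def L_sharp_def power_divide)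
qed

section \<open>Products of eigenvalues\<close>

text \<open>
  The finite entries of the list of eigenvalues are the roots of the determinant with
  multiplicities, so they index its factorization into linear factors.
\<close>

lemma eigenvalues_factorization:
  fixes A :: "nat \<Rightarrow> complex^'n^'n"
  assumes "eigenvalues_by_modulus A d \<zeta>"
  defines "J \<equiv> {i \<in> {1..CARD('n) * d}. \<zeta> i \<noteq> None}"
  shows "poly (det (matpoly A d)) x = lead_coeff (det (matpoly A d)) * (\<Prod>i\<in>J. x - the (\<zeta> i))"
proof -
  define p where "p = det (matpoly A d)"
  have "image_mset the (filter_mset (\<lambda>z. z \<noteq> None) (image_mset \<zeta> (mset_set {1..CARD('n) * d})))
      = image_mset the (filter_mset (\<lambda>z. z \<noteq> None) (eigenvalues A d))"
    using assms(1) by (simp add: eigenvalues_by_modulus_def)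
  also have "\<dots> = proots p"
    by (simp add: eigenvalues_def p_def filter_mset_image_mset o_def multiset.map_comp)
  also have "image_mset the (filter_mset (\<lambda>z. z \<noteq> None) (image_mset \<zeta> (mset_set {1..CARD('n) * d})))
      = image_mset (\<lambda>i. the (\<zeta> i)) (mset_set J)"
    by (simp add: J_def filter_mset_image_mset multiset.map_comp o_def)
  finally have "proots p = image_mset (\<lambda>i. the (\<zeta> i)) (mset_set J)" by simp
  then have "poly p x = lead_coeff p * poly (\<Prod>x\<in>#image_mset (\<lambda>i. the (\<zeta> i)) (mset_set J). [:-x, 1:]) x"
    using complex_poly_decompose_multiset[of p] by (metis poly_smult)
  then show ?thesis
    by (simp add: p_def poly_prod multiset.map_comp o_def flip: prod_unfold_prod_mset)
qed

theorem theorem4p6: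
  fixes A :: "nat \<Rightarrow> complex^'n^'n" and d k :: nat
    and N :: "complex^'n^'n \<Rightarrow> real"
    and \<zeta> :: "nat \<Rightarrow> complex option"
    and \<alpha> :: "nat \<Rightarrow> real"
    and c \<delta>m \<delta>p :: real
  assumes "1 \<le> d" and "A d \<noteq> 0"
    and "eigenvalues_by_modulus A d \<zeta>"
    and "is_matrix_space_norm N" and "cond_A1 N"
    and "det (A 0) \<noteq> 0"
    and "c = cmod (det (A 0)) / N (A 0) ^ CARD('n)"
    and "tropical_roots N A d \<alpha>" and "\<alpha> 0 = 0"
    and "k \<in> {1..d}"
    and "\<delta>m = \<alpha> (k - 1) / \<alpha> k"
    and "\<delta>p = (if k = d then 0 else \<alpha> k / \<alpha> (k + 1))"
  shows "(\<Prod>j=1..CARD('n) * k. modulus (\<zeta> j)) / ereal ((\<Prod>j=1..k. \<alpha> j) ^ CARD('n))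
           \<ge> ereal (c * L_sharp \<delta>m \<delta>p ^ CARD('n))
       \<and> (cond_A2 N \<longrightarrow>
           (\<Prod>j=1..CARD('n) * k. modulus (\<zeta> j)) / ereal ((\<Prod>j=1..k. \<alpha> j) ^ CARD('n))
             \<ge> ereal (c * L_star_sharp \<delta>m \<delta>p ^ CARD('n)))
       \<and> L_sharp \<delta>m \<delta>p \<ge> L_max \<delta>m \<delta>p
       \<and> L_star_sharp \<delta>m \<delta>p \<ge> L_star_max \<delta>m \<delta>p"
proof -
  define n where "n = CARD('n)"
  define B where "B = (\<Prod>j=1..k. \<alpha> j)"
  define I where "I = {1..n * k}"
  define J where "J = {i \<in> {1..n * d}. \<zeta> i \<noteq> None}"
  define E where "E = (\<Prod>j\<in>I. modulus (\<zeta> j))"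
  define Z where "Z = (\<Prod>i\<in>I. cmod (the (\<zeta> i))) / B ^ n"
  define p where "p = det (matpoly A d)"
  have n0: "0 < n" by (simp add: n_def)
  have A0: "A 0 \<noteq> 0"
  proof
    assume "A 0 = 0"
    then have "row undefined (A 0) = 0" by (simp add: row_def vec_eq_iff)
    then show False using det_zero_row(1) assms(6) by blast
  qed
  have N0: "0 \<le> N X" "N X = 0 \<longleftrightarrow> X = 0" for X using assms(4) by (auto simp: is_matrix_space_norm_def)
  have NA0: "0 < N (A 0)" using N0[of "A 0"] A0 by simp
  have pos: "0 < \<alpha> j" if "j \<in> {1..d}" for j
    by (rule tropical_coeff_bounds(1)[OF assms(1,4) A0 assms(8) that])
  have coeff: "N (A j) \<le> N (A 0) / (\<Prod>i=1..j. \<alpha> i)" if "j \<le> d" for j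
    by (rule tropical_coeff_bounds(2)[OF assms(1,4) A0 assms(8) that])
  have mono: "mono_on {1..d} \<alpha>" using assms(8) by (simp add: tropical_roots_def)
  have kd: "1 \<le> k" "k \<le> d" using assms(10) by auto
  have ak: "0 < \<alpha> k" using pos assms(10) by simp
  have B0: "0 < B" unfolding B_def using pos kd by (intro prod_pos) auto
  have ak1: "0 \<le> \<alpha> (k - 1)" "\<alpha> (k - 1) \<le> \<alpha> k"
  proof -
    have "0 \<le> \<alpha> (k - 1) \<and> \<alpha> (k - 1) \<le> \<alpha> k"
    proof (cases "k = 1")
      case True
      then show ?thesis using ak assms(9) by simp
    next
      case False
      then have k1: "k - 1 \<in> {1..d}" "k - 1 \<le> k" using kd by auto
      then have "\<alpha> (k - 1) \<le> \<alpha> k" using mono assms(10) unfolding mono_on_def by blast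
      then show ?thesis using pos[OF k1(1)] by simp
    qed
    then show "0 \<le> \<alpha> (k - 1)" "\<alpha> (k - 1) \<le> \<alpha> k" by auto
  qed
  have \<delta>m: "0 \<le> \<delta>m" "\<delta>m \<le> 1" using ak ak1 by (auto simp: assms(11))
  have \<delta>p: "0 \<le> \<delta>p" "\<delta>p \<le> 1"
    using ak pos[of "k + 1"] mono kd by (auto simp: assms(12) mono_on_def)
  have c0: "0 \<le> c" using N0 by (simp add: assms(7))
  have Z0: "0 \<le> Z" unfolding Z_def using B0 by (intro divide_nonneg_pos prod_nonneg) auto

  have pA: "poly p 0 = det (A 0)" by (simp add: p_def poly_det_matpoly matpoly_at_0)
  have ev: "poly p x = lead_coeff p * (\<Prod>i\<in>J. x - the (\<zeta> i))" for x
    unfolding p_def J_def n_def by (rule eigenvalues_factorization[OF assms(3)])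
  have a0: "lead_coeff p \<noteq> 0" using pA assms(6) by auto

  \<comment> \<open>If an infinite eigenvalue is among the first \<open>n k\<close>, the product is infinite, for no eigenvalue is zero.\<close>
  show ?thesis
  proof (cases "\<exists>i\<in>I. \<zeta> i = None")
    case True
    have IJ: "I \<subseteq> {1..n * d}" using kd by (auto simp: I_def intro: order_trans)
    have nz: "the (\<zeta> i) \<noteq> 0" if "i \<in> J" for i
    proof
      assume "the (\<zeta> i) = 0"
      then have "poly p 0 = 0" unfolding ev using that by (auto simp: J_def)
      then show False using pA assms(6) by simp
    qed
    have "modulus (\<zeta> i) \<noteq> 0" if "i \<in> I" for i
      using nz[of i] that IJ by (cases "\<zeta> i") (auto simp: modulus_def J_def zero_ereal_def)
    moreover have "0 \<le> modulus z" for z by (cases z) (auto simp: modulus_def)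
    moreover have "\<exists>i\<in>I. modulus (\<zeta> i) = \<infinity>" using True by (force simp: modulus_def)
    ultimately have "E = \<infinity>"
      unfolding E_def by (subst prod_PInf) (auto simp: I_def)
    then have "E / ereal (B ^ n) = \<infinity>" using B0 by simp
    then show ?thesis
      using L_max_le_L_sharp[OF \<delta>m \<delta>p] L_star_max_le_L_star_sharp[OF \<delta>m \<delta>p]
      by (simp add: E_def B_def n_def I_def)
  next
    case False
    then have IJ: "I \<subseteq> J" using kd by (auto simp: I_def J_def intro: order_trans)
    have "E = (\<Prod>j\<in>I. ereal (cmod (the (\<zeta> j))))"
      unfolding E_def using False by (intro prod.cong) (auto simp: modulus_def)
    then have E: "E / ereal (B ^ n) = ereal Z" using B0 by (simp add: prod_ereal Z_def)
    have J: "finite J" by (simp add: J_def)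
    \<comment> \<open>Jensen's inequality, normalized by the term of index \<open>k\<close> of the tropical majorant.\<close>
    have bound: "c * (N (A 0) * r ^ k / B) ^ n \<le> G r * Z"
      if r: "0 < r" and G: "\<And>s. 0 \<le> G s" "isCont G r"
        and le: "\<And>s n. 0 < s \<Longrightarrow> d < n \<Longrightarrow> (\<Prod>w | w ^ n = 1. cmod (poly p (of_real s * w))) \<le> G s ^ n"
      for r G
    proof -
      have "cmod (poly p 0) * r ^ card I \<le> G r * (\<Prod>i\<in>I. cmod (the (\<zeta> i)))"
        by (rule root_product_bound[OF J ev a0 IJ r G le])
      then have "cmod (det (A 0)) * (r ^ k) ^ n \<le> G r * Z * B ^ n"
        using B0 by (simp add: pA Z_def I_def mult.commute flip: power_mult)
      then show ?thesis using B0 NA0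
        by (simp add: assms(7) n_def[symmetric] power_divide power_mult_distrib field_simps)
    qed
    have "c * L_sharp \<delta>m \<delta>p ^ n \<le> Z"
    proof (rule L_sharp_power_le[OF \<delta>m \<delta>p c0 Z0 n0])
      fix t assume t: "\<delta>m < t" "\<delta>p * t < 1"
      let ?f = "1 / (1 - \<delta>p * t) + 1 / (t - \<delta>m)"
      define r where "r = \<alpha> k * t"
      have r0: "0 < r" using ak t \<delta>m by (simp add: r_def)
      define S where "S s = (\<Sum>l\<le>d. N (A l) * s ^ l)" for s
      \<comment> \<open>The absolute value makes the majorant nonnegative for negative arguments too.\<close>
      have "c * (N (A 0) * r ^ k / B) ^ n \<le> (\<bar>S r\<bar> ^ n) * Z"
      proof (rule bound[OF r0])
        show "isCont (\<lambda>r. \<bar>S r\<bar> ^ n) r" unfolding S_def by (intro continuous_intros)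
        fix s :: real and q assume s: "0 < s" "d < q"
        have "0 \<le> S s" unfolding S_def using s N0 by (intro sum_nonneg) auto
        then show "(\<Prod>w | w ^ q = 1. cmod (poly p (of_real s * w))) \<le> (\<bar>S s\<bar> ^ n) ^ q"
          using prod_det_le_A1[OF assms(4,5) s(1), of q A d] s by (simp add: S_def p_def n_def)
      qed simp
      also have "\<bar>S r\<bar> = S r" unfolding S_def using r0 N0 by (intro abs_of_nonneg sum_nonneg) auto
      also have "S r ^ n * Z \<le> (N (A 0) * r ^ k / B * ?f) ^ n * Z"
      proof (intro mult_right_mono power_mono Z0)
        show "0 \<le> S r" unfolding S_def using r0 N0 by (intro sum_nonneg) auto
        have "S r \<le> (\<Sum>l\<le>d. N (A 0) / (\<Prod>i=1..l. \<alpha> i) * r ^ l)"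
          unfolding S_def using coeff r0 by (intro sum_mono mult_right_mono) auto
        also have "\<dots> = N (A 0) * (\<Sum>l\<le>d. r ^ l / (\<Prod>i=1..l. \<alpha> i))" by (simp add: sum_distrib_left)
        also have "\<dots> \<le> N (A 0) * (r ^ k / B * ?f)"
          unfolding r_def B_def
          using sum_at_tropical_root[OF pos mono assms(9-12) t] N0 by (intro mult_left_mono) auto
        finally show "S r \<le> N (A 0) * r ^ k / B * ?f" by (simp add: mult.assoc)
      qed
      finally have "c * (N (A 0) * r ^ k / B) ^ n \<le> (Z * ?f ^ n) * (N (A 0) * r ^ k / B) ^ n"
        unfolding power_mult_distrib[of _ ?f] by (simp only: mult_ac)
      then show "c \<le> Z * ?f ^ n" using NA0 r0 B0 by (simp add: mult_le_cancel_right)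
    qed
    moreover have "c * L_star_sharp \<delta>m \<delta>p ^ n \<le> Z" if A2: "cond_A2 N"
    proof (rule power2_le_imp_le[OF _ Z0])
      have "c\<^sup>2 * L_sharp (\<delta>m\<^sup>2) (\<delta>p\<^sup>2) ^ n \<le> Z\<^sup>2"
      proof (rule L_sharp_power_le)
        fix t assume t: "\<delta>m\<^sup>2 < t" "\<delta>p\<^sup>2 * t < 1"
        let ?f = "1 / (1 - \<delta>p\<^sup>2 * t) + 1 / (t - \<delta>m\<^sup>2)"
        have t0: "0 < t" using t(1) by (rule le_less_trans[rotated]) simp
        \<comment> \<open>Here \<open>t\<close> is the square of the ratio of the radius to \<open>\<alpha>\<^sub>k\<close>, as the tropical estimate is used for squares.\<close>
        define r where "r = \<alpha> k * sqrt t"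
        have r0: "0 < r" using ak t0 by (simp add: r_def)
        have r2: "r\<^sup>2 = (\<alpha> k)\<^sup>2 * t" using t0 by (simp add: r_def power_mult_distrib)
        define S where "S s = (\<Sum>l\<le>d. (N (A l))\<^sup>2 * (s\<^sup>2) ^ l)" for s
        have S0: "0 \<le> S s" for s unfolding S_def by (intro sum_nonneg) auto
        have "c * (N (A 0) * r ^ k / B) ^ n \<le> (sqrt (S r) ^ n) * Z"
        proof (rule bound[OF r0])
          show "isCont (\<lambda>r. sqrt (S r) ^ n) r" unfolding S_def by (intro continuous_intros)
          show "0 \<le> sqrt (S s) ^ n" for s using S0 by simp
          fix s :: real and q assume s: "0 < s" "d < q"
          show "(\<Prod>w | w ^ q = 1. cmod (poly p (of_real s * w))) \<le> (sqrt (S s) ^ n) ^ q"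
            using prod_det_le_A2[OF A2 s(2), of A s] by (simp add: S_def p_def n_def)
        qed
        then have "(c * (N (A 0) * r ^ k / B) ^ n)\<^sup>2 \<le> ((sqrt (S r) ^ n) * Z)\<^sup>2"
          using c0 NA0 r0 B0 by (intro power_mono mult_nonneg_nonneg) auto
        also have "\<dots> = S r ^ n * Z\<^sup>2"
        proof -
          have "(sqrt (S r) ^ n)\<^sup>2 = ((sqrt (S r))\<^sup>2) ^ n" by (simp only: power_mult[symmetric] mult.commute)
          then show ?thesis using S0 by (simp add: power_mult_distrib)
        qed
        also have "S r ^ n * Z\<^sup>2 \<le> ((N (A 0) * r ^ k / B)\<^sup>2 * ?f) ^ n * Z\<^sup>2"
        proof (intro mult_right_mono power_mono S0)
          have "S r \<le> (\<Sum>l\<le>d. (N (A 0) / (\<Prod>i=1..l. \<alpha> i))\<^sup>2 * (r\<^sup>2) ^ l)"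
            unfolding S_def using coeff N0 by (intro sum_mono mult_right_mono power_mono) auto
          also have "\<dots> = (N (A 0))\<^sup>2 * (\<Sum>l\<le>d. ((\<alpha> k)\<^sup>2 * t) ^ l / (\<Prod>i=1..l. (\<alpha> i)\<^sup>2))"
            by (simp add: sum_distrib_left power_divide r2 prod_power_distrib)
          also have "\<dots> \<le> (N (A 0))\<^sup>2 * (((\<alpha> k)\<^sup>2 * t) ^ k / (\<Prod>i=1..k. (\<alpha> i)\<^sup>2) * ?f)"
          proof (intro mult_left_mono sum_at_tropical_root[where \<beta> = "\<lambda>j. (\<alpha> j)\<^sup>2"])
            show "mono_on {1..d} (\<lambda>j. (\<alpha> j)\<^sup>2)"
            proof (rule mono_onI)
              fix i j assume ij: "i \<in> {1..d}" "j \<in> {1..d}" "i \<le> j"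
              then have "\<alpha> i \<le> \<alpha> j" using mono by (auto simp: mono_on_def)
              then show "(\<alpha> i)\<^sup>2 \<le> (\<alpha> j)\<^sup>2" using pos[OF ij(1)] by (intro power_mono) auto
            qed
            show "\<delta>p\<^sup>2 = (if k = d then 0 else (\<alpha> k)\<^sup>2 / (\<alpha> (k + 1))\<^sup>2)"
              by (simp add: assms(12) power_divide)
            show "0 < (\<alpha> j)\<^sup>2" if "j \<in> {1..d}" for j using pos[OF that] by simp
          qed (use assms t in \<open>auto simp: power_divide\<close>)
          also have "\<dots> = (N (A 0) * r ^ k / B)\<^sup>2 * ?f"
          proof -
            have "(r ^ k)\<^sup>2 = (r\<^sup>2) ^ k" by (simp only: power_mult[symmetric] mult.commute)
            then have "(r ^ k)\<^sup>2 = ((\<alpha> k)\<^sup>2 * t) ^ k" unfolding r2 .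
            then show ?thesis by (simp add: B_def power_mult_distrib power_divide prod_power_distrib)
          qed
          finally show "S r \<le> (N (A 0) * r ^ k / B)\<^sup>2 * ?f" .
        qed simp
        also have "\<dots> = (Z\<^sup>2 * ?f ^ n) * ((N (A 0) * r ^ k / B) ^ n)\<^sup>2"
          by (simp only: power_mult_distrib power_mult[symmetric] mult_ac)
        finally have "c\<^sup>2 * ((N (A 0) * r ^ k / B) ^ n)\<^sup>2 \<le> (Z\<^sup>2 * ?f ^ n) * ((N (A 0) * r ^ k / B) ^ n)\<^sup>2"
          by (simp only: power_mult_distrib[of c])
        then show "c\<^sup>2 \<le> Z\<^sup>2 * ?f ^ n" using NA0 r0 B0 by (simp add: mult_le_cancel_right)
      qed (use \<delta>m \<delta>p n0 in \<open>auto simp: power_le_one\<close>)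
      then show "(c * L_star_sharp \<delta>m \<delta>p ^ n)\<^sup>2 \<le> Z\<^sup>2"
        by (simp add: power_mult_distrib L_star_sharp_square(1)[OF \<delta>m \<delta>p, symmetric] flip: power_mult)
           (simp add: mult.commute)
    qed
    ultimately show ?thesis
      using L_max_le_L_sharp[OF \<delta>m \<delta>p] L_star_max_le_L_star_sharp[OF \<delta>m \<delta>p] E
      by (simp add: E_def B_def n_def I_def)
  qed
qed

end
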